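(* Let $r\ge 2$ and $d\ge 1$ be integers and $0<\varepsilon\le 1$ a real number, and let $p_r$ be the probability that a uniformly random permutation of an $r$-element set has at least one fixed point. Let \[ m=\left\lfloor \frac{\ln(\varepsilon)}{\ln(1-p_r)}\right\rfloor+1 . \] Then there is an integer $N_0$ such that for every $N\ge N_0$ the following holds. If $\mathcal{F}=\{F_1,\ldots,F_N\}$ is a family of $N$ pairwise disjoint sets of $r$ points each in $\mathbb{R}^d$, then there exist $m$ colorful partitions $\mathcal{P}_1,\ldots,\mathcal{P}_m$ of $\bigcup\mathcal{F}$ such that for every $\mathcal{G}\subset\mathcal{F}$ with $|\mathcal{G}|\ge\varepsilon|\mathcal{F}|$ there is a $k$ for which the restriction of $\mathcal{P}_k$ to $\bigcup\mathcal{G}$ is a Tverberg partition of $\bigcup\mathcal{G}$ (this restriction is automatically a colorful partition of $\mathcal{G}$). In particular, the smallest number $m_{\mathrm{col}}(\varepsilon,r)$ of colorful partitions with this property satisfies $m_{\mathrm{col}}(\varepsilon,r)\le \left\lfloor \frac{\ln(\varepsilon)}{\ln(1-p_r)}\right\rfloor+1$.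
   Context: Given a family $\mathcal{F}$ of sets of $r$ points each (the "colors"), a colorful partition is a partition of $\bigcup\mathcal{F}$ into $r$ sets $X_1,\ldots,X_r$ with $|F\cap X_j|=1$ for every $F\in\mathcal{F}$ and every $j$. The restriction of a partition $X_1,\ldots,X_r$ to a subset $Y$ is the partition $X_1\cap Y,\ldots,X_r\cap Y$. A partition of a finite set $Y\subset\mathbb{R}^d$ into $r$ sets $Y_1,\dots,Y_r$ is a Tverberg partition if $\bigcap_{j=1}^r\operatorname{conv}(Y_j)\ne\emptyset$. *)

theory Defs
  imports "HOL-Probability.Probability" "HOL-Combinatorics.Permutations"
begin

definition fixpoint_prob :: "nat \<Rightarrow> real" where
  "fixpoint_prob r =
     measure_pmf.prob (pmf_of_set {\<pi>. \<pi> permutes {..<r}}) {\<pi>. \<exists>i<r. \<pi> i = i}"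

text \<open>Partitions into \<open>r\<close> parts are indexed families \<open>X 0, \<dots>, X (r - 1)\<close>; the values
  of \<open>X\<close> at indices \<open>\<ge> r\<close> are irrelevant. A part may be empty.\<close>

definition indexed_partition :: "nat \<Rightarrow> 'a set \<Rightarrow> (nat \<Rightarrow> 'a set) \<Rightarrow> bool" where
  "indexed_partition r Y X \<longleftrightarrow> (\<Union>j<r. X j) = Y \<and> disjoint_family_on X {..<r}"

definition restrict_partition :: "(nat \<Rightarrow> 'a set) \<Rightarrow> 'a set \<Rightarrow> nat \<Rightarrow> 'a set" where
  "restrict_partition X Y = (\<lambda>j. X j \<inter> Y)"

definition colorful_partition :: "nat \<Rightarrow> 'a set set \<Rightarrow> (nat \<Rightarrow> 'a set) \<Rightarrow> bool" where
  "colorful_partition r \<F> X \<longleftrightarrow>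
     indexed_partition r (\<Union>\<F>) X \<and> (\<forall>F\<in>\<F>. \<forall>j<r. card (F \<inter> X j) = 1)"

definition tverberg_partition ::
    "nat \<Rightarrow> 'a::real_vector set \<Rightarrow> (nat \<Rightarrow> 'a set) \<Rightarrow> bool" where
  "tverberg_partition r Y X \<longleftrightarrow>
     finite Y \<and> indexed_partition r Y X \<and> (\<Inter>j<r. convex hull (X j)) \<noteq> {}"

definition color_family :: "nat \<Rightarrow> nat \<Rightarrow> 'a set set \<Rightarrow> bool" where
  "color_family r N \<F> \<longleftrightarrow>
     finite \<F> \<and> card \<F> = N \<and> (\<forall>F\<in>\<F>. finite F \<and> card F = r) \<and> pairwise disjnt \<F>"

definition has_tverberg_cover ::
    "real \<Rightarrow> nat \<Rightarrow> nat \<Rightarrow> 'a::real_vector set set \<Rightarrow> bool" where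
  "has_tverberg_cover \<epsilon> r m \<F> \<longleftrightarrow>
     (\<exists>P :: nat \<Rightarrow> nat \<Rightarrow> 'a set.
        (\<forall>k<m. colorful_partition r \<F> (P k)) \<and>
        (\<forall>\<G>. \<G> \<subseteq> \<F> \<and> real (card \<G>) \<ge> \<epsilon> * real (card \<F>) \<longrightarrow>
           (\<exists>k<m. tverberg_partition r (\<Union>\<G>) (restrict_partition (P k) (\<Union>\<G>)))))"

text \<open>The least \<open>m\<close> such that \<open>m\<close> colorful partitions suffice for all sufficiently large
  families in \<open>d\<close>-space. The first argument only fixes the dimension \<open>d = CARD('d)\<close>.\<close>

definition m_col :: "'d::finite itself \<Rightarrow> real \<Rightarrow> nat \<Rightarrow> nat" where
  "m_col (_ :: 'd itself) \<epsilon> r =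
     (LEAST m. \<exists>N0. \<forall>N\<ge>N0. \<forall>\<F> :: (real ^ 'd) set set.
        color_family r N \<F> \<longrightarrow> has_tverberg_cover \<epsilon> r m \<F>)"

end

theory Submission imports Defs begin

text \<open>
  Order every color and choose \<open>m\<close> independent uniformly random permutations for it; the \<open>k\<close>-th
  permutations of all colors form the \<open>k\<close>-th colorful partition. If the convex hulls of the parts of
  its restriction to \<open>\<G>\<close> have no common point, they lie in open half-spaces without a common point.
  The complementary closed half-spaces \<open>H\<^sub>0, \<dots>, H\<^sub>r\<^sub>-\<^sub>1\<close> cover the space, while no color of \<open>\<G>\<close> has
  its \<open>j\<close>-th point in \<open>H\<^sub>j\<close> for any \<open>j\<close>. For a fixed cover, a randomly permuted color evades the
  half-spaces in this way with probability at most \<open>1 - p\<^sub>r\<close>, the derangements being the extremal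
  case. Hence it evades \<open>m\<close> fixed covers with probability at most \<open>(1 - p\<^sub>r)\<^sup>m < \<epsilon>\<close>, and by
  Hoeffding's inequality the probability that at least \<open>\<epsilon> N\<close> colors do so is exponentially small
  in \<open>N\<close>. Since half-spaces cut out only polynomially many subsets of the \<open>r N\<close> points, a union
  bound over all \<open>m\<close>-tuples of covers finishes the proof.
\<close>

section \<open>Shattering and the Sauer--Shelah lemma\<close>

definition shatters :: "'a set set \<Rightarrow> 'a set \<Rightarrow> bool" where
  "shatters \<A> S \<longleftrightarrow> (\<forall>T\<subseteq>S. \<exists>A\<in>\<A>. S \<inter> A = T)"

definition deletion :: "'a \<Rightarrow> 'a set set \<Rightarrow> 'a set set" where
  "deletion x \<A> = {A \<in> \<A>. x \<notin> A}"

definition link :: "'a \<Rightarrow> 'a set set \<Rightarrow> 'a set set" where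
  "link x \<A> = {A. x \<notin> A \<and> insert x A \<in> \<A>}"

lemma shattersD:
  assumes "shatters \<A> S" "T \<subseteq> S"
  obtains A where "A \<in> \<A>" "S \<inter> A = T"
  using assms unfolding shatters_def by blast

lemma shattered_subset:
  assumes "\<A> \<subseteq> Pow X" "shatters \<A> S"
  shows "S \<subseteq> X"
proof -
  obtain A where "A \<in> \<A>" "S \<inter> A = S" using assms(2) order_refl by (rule shattersD)
  then show ?thesis using assms(1) by blast
qed

lemma shatters_mono: "shatters \<A> S \<Longrightarrow> \<A> \<subseteq> \<B> \<Longrightarrow> shatters \<B> S"
  unfolding shatters_def by (meson subsetD)

lemma shatters_of_link:
  assumes "shatters (link x \<A>) S" "x \<notin> S"
  shows "shatters \<A> S"
  unfolding shatters_def
proof (intro allI impI)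
  fix T assume "T \<subseteq> S"
  with assms(1) obtain A where "A \<in> link x \<A>" "S \<inter> A = T" by (rule shattersD)
  then show "\<exists>A\<in>\<A>. S \<inter> A = T"
    using \<open>x \<notin> S\<close> by (intro bexI[of _ "insert x A"]) (auto simp: link_def)
qed

lemma shatters_insert:
  assumes "shatters (deletion x \<A>) S" "shatters (link x \<A>) S"
  shows "shatters \<A> (insert x S)"
  unfolding shatters_def
proof (intro allI impI)
  fix T assume T: "T \<subseteq> insert x S"
  show "\<exists>A\<in>\<A>. insert x S \<inter> A = T"
  proof (cases "x \<in> T")
    case True
    have "S \<inter> (T - {x}) \<subseteq> S" by blast
    with assms(2) obtain A where "A \<in> link x \<A>" "S \<inter> A = S \<inter> (T - {x})" by (rule shattersD)
    then show ?thesis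
      using True T by (intro bexI[of _ "insert x A"]) (auto simp: link_def)
  next
    case False
    with T have "T \<subseteq> S" by blast
    with assms(1) obtain A where "A \<in> deletion x \<A>" "S \<inter> A = T" by (rule shattersD)
    then show ?thesis by (intro bexI[of _ A]) (auto simp: deletion_def)
  qed
qed

lemma card_eq_deletion_plus_link:
  assumes "finite \<A>"
  shows "card \<A> = card (deletion x \<A>) + card (link x \<A>)"
proof -
  have "\<A> = deletion x \<A> \<union> insert x ` link x \<A>"
  proof (intro set_eqI iffI)
    fix A assume "A \<in> \<A>"
    moreover have "A = insert x (A - {x})" if "x \<in> A" using that by blast
    ultimately show "A \<in> deletion x \<A> \<union> insert x ` link x \<A>"
      by (cases "x \<in> A")
        (auto simp: deletion_def link_def insert_absorb intro!: image_eqI[of _ _ "A - {x}"])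
  qed (auto simp: deletion_def link_def)
  moreover have "card (insert x ` link x \<A>) = card (link x \<A>)"
    by (intro card_image inj_onI) (auto simp: link_def insert_ident)
  moreover have "finite (deletion x \<A>)" "finite (insert x ` link x \<A>)"
    using assms calculation(1) by (metis finite_Un)+
  moreover have "deletion x \<A> \<inter> insert x ` link x \<A> = {}"
    by (auto simp: deletion_def)
  ultimately show ?thesis by (metis card_Un_disjoint)
qed

lemma card_shattered_deletion_link_le:
  assumes "finite X" "\<A> \<subseteq> Pow (insert x X)"
  shows "card {S. shatters (deletion x \<A>) S} + card {S. shatters (link x \<A>) S}
    \<le> card {S. shatters \<A> S}"
proof -
  let ?D = "{S. shatters (deletion x \<A>) S}" and ?L = "{S. shatters (link x \<A>) S}"
  have sub: "?D \<subseteq> Pow (X - {x})" "?L \<subseteq> Pow (X - {x})"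
    using assms(2)
    by (auto dest!: shattered_subset[of _ "X - {x}", rotated] simp: deletion_def link_def)
  then have notin: "x \<notin> S" if "S \<in> ?D \<union> ?L" for S using that by blast
  have fin: "finite ?D" "finite ?L"
    using sub assms(1) by (meson finite_Diff finite_Pow_iff finite_subset)+
  have "card ?D + card ?L = card (?D \<union> ?L) + card (?D \<inter> ?L)" using fin by (rule card_Un_Int)
  also have "card (?D \<inter> ?L) = card (insert x ` (?D \<inter> ?L))"
    by (intro card_image[symmetric] inj_onI) (metis IntD1 UnI1 insert_ident notin)
  also have "card (?D \<union> ?L) + \<dots> = card (?D \<union> ?L \<union> insert x ` (?D \<inter> ?L))"
    using fin notin by (intro card_Un_disjoint[symmetric]) auto
  also have "\<dots> \<le> card {S. shatters \<A> S}"
  proof (rule card_mono)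
    have "{S. shatters \<A> S} \<subseteq> Pow (insert x X)" using assms(2) by (auto dest: shattered_subset)
    then show "finite {S. shatters \<A> S}" using assms(1) by (simp add: finite_subset)
    have "shatters \<A> S" if "S \<in> ?D" for S
      using that by (auto intro: shatters_mono simp: deletion_def)
    moreover have "shatters \<A> S" if "S \<in> ?L" for S
      using that notin[of S] by (auto intro: shatters_of_link)
    ultimately show "?D \<union> ?L \<union> insert x ` (?D \<inter> ?L) \<subseteq> {S. shatters \<A> S}"
      by (auto intro: shatters_insert)
  qed
  finally show ?thesis .
qed

lemma pajor_card_le_card_shattered:
  assumes "finite X" "\<A> \<subseteq> Pow X"
  shows "card \<A> \<le> card {S. shatters \<A> S}"
  using assms
proof (induction X arbitrary: \<A> rule: finite_induct)
  case empty
  then consider "\<A> = {}" | "\<A> = {{}}" by (auto simp: subset_singleton_iff)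
  then show ?case
  proof cases
    assume "\<A> = {{}}"
    then have "{S. shatters \<A> S} = {{}}" by (auto simp: shatters_def)
    with \<open>\<A> = {{}}\<close> show ?thesis by simp
  qed simp
next
  case (insert x X)
  have sub: "deletion x \<A> \<subseteq> Pow X" "link x \<A> \<subseteq> Pow X"
    using insert.prems by (auto simp: deletion_def link_def)
  have "finite \<A>" using insert.prems insert.hyps by (simp add: finite_subset)
  then have "card \<A> = card (deletion x \<A>) + card (link x \<A>)" by (rule card_eq_deletion_plus_link)
  also have "\<dots> \<le> card {S. shatters (deletion x \<A>) S} + card {S. shatters (link x \<A>) S}"
    using insert.IH sub by (intro add_mono)
  also have "\<dots> \<le> card {S. shatters \<A> S}"
    using insert.hyps(1) insert.prems by (rule card_shattered_deletion_link_le)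
  finally show ?case .
qed

lemma card_subsets_card_le:
  assumes "finite X"
  shows "card {S. S \<subseteq> X \<and> card S \<le> k} \<le> (card X + 1) ^ k"
proof (induction k)
  case 0
  have "{S. S \<subseteq> X \<and> card S \<le> 0} = {{}}" using assms by (auto dest: finite_subset)
  then show ?case by simp
next
  case (Suc k)
  let ?S = "\<lambda>k. {S. S \<subseteq> X \<and> card S \<le> k}"
  have fin: "finite (?S k)" using assms by simp
  have "?S (Suc k) \<subseteq> ?S k \<union> case_prod insert ` (X \<times> ?S k)"
  proof
    fix S assume S: "S \<in> ?S (Suc k)"
    show "S \<in> ?S k \<union> case_prod insert ` (X \<times> ?S k)"
    proof (cases "card S \<le> k")
      case False
      then obtain x where "x \<in> S" by fastforce
      then have "S = insert x (S - {x})" "(x, S - {x}) \<in> X \<times> ?S k" using S by auto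
      then show ?thesis by (metis (lifting) UnI2 case_prod_conv image_eqI)
    qed (use S in auto)
  qed
  then have "card (?S (Suc k)) \<le> card (?S k \<union> case_prod insert ` (X \<times> ?S k))"
    using fin assms by (intro card_mono) auto
  also have "\<dots> \<le> card (?S k) + card (case_prod insert ` (X \<times> ?S k))"
    by (rule card_Un_le)
  also have "\<dots> \<le> card (?S k) + card (X \<times> ?S k)"
    using fin assms by (intro add_left_mono card_image_le) auto
  also have "\<dots> \<le> (card X + 1) ^ Suc k"
    using Suc.IH by (simp add: card_cartesian_product algebra_simps mult_le_mono add_mono)
  finally show ?case .
qed

lemma sauer_shelah:
  assumes "finite X" "\<A> \<subseteq> Pow X" and "\<And>S. shatters \<A> S \<Longrightarrow> card S \<le> d"
  shows "card \<A> \<le> (card X + 1) ^ d"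
proof -
  have "card \<A> \<le> card {S. shatters \<A> S}" using assms(1,2) by (rule pajor_card_le_card_shattered)
  also have "\<dots> \<le> card {S. S \<subseteq> X \<and> card S \<le> d}"
    using assms by (intro card_mono) (auto dest: shattered_subset)
  also have "\<dots> \<le> (card X + 1) ^ d" using assms(1) by (rule card_subsets_card_le)
  finally show ?thesis .
qed

section \<open>Half-spaces\<close>

definition halfspace_sections :: "'a::euclidean_space set \<Rightarrow> 'a set set" where
  "halfspace_sections X = {X \<inter> {x. b \<le> c \<bullet> x} | c b. True}"

lemma finite_halfspace_sections: "finite X \<Longrightarrow> finite (halfspace_sections X)"
  by (rule finite_subset[of _ "Pow X"]) (auto simp: halfspace_sections_def)

lemma card_shattered_by_halfspace_sections:
  fixes X S :: "'a::euclidean_space set"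
  assumes shat: "shatters (halfspace_sections X) S"
  shows "card S \<le> DIM('a) + 1"
proof (rule ccontr)
  assume large: "\<not> ?thesis"
  then have "finite S" by (metis card.infinite le0)
  with large have "affine_dependent S" by (intro affine_dependent_biggerset) auto
  then obtain M P where radon: "M \<subseteq> S" "P \<subseteq> S" "M \<inter> P = {}" "convex hull M \<inter> convex hull P \<noteq> {}"
    by (rule Radon)
  have "S \<subseteq> X" using shat by (rule shattered_subset[rotated]) (auto simp: halfspace_sections_def)
  obtain A where "A \<in> halfspace_sections X" "S \<inter> A = M" using shattersD[OF shat radon(1)] .
  then obtain c b where "S \<inter> (X \<inter> {x. b \<le> c \<bullet> x}) = M" by (auto simp: halfspace_sections_def)
  with \<open>S \<subseteq> X\<close> have M: "M = {x \<in> S. b \<le> c \<bullet> x}" by blast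
  then have "convex hull M \<subseteq> {x. c \<bullet> x \<ge> b}"
    by (intro hull_minimal convex_halfspace_ge) auto
  moreover have "convex hull P \<subseteq> {x. c \<bullet> x < b}"
    using M radon(2,3) by (intro hull_minimal convex_halfspace_lt) fastforce
  ultimately show False using radon(4) by fastforce
qed

lemma card_halfspace_sections:
  fixes X :: "'a::euclidean_space set"
  assumes "finite X"
  shows "card (halfspace_sections X) \<le> (card X + 1) ^ (DIM('a) + 1)"
  using assms card_shattered_by_halfspace_sections
  by (intro sauer_shelah) (auto simp: halfspace_sections_def)

definition halfspace_covers :: "nat \<Rightarrow> 'a::euclidean_space set \<Rightarrow> (nat \<Rightarrow> 'a set) set" where
  "halfspace_covers r X = {S \<in> {..<r} \<rightarrow>\<^sub>E halfspace_sections X. X \<subseteq> (\<Union>j<r. S j)}"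

lemma finite_halfspace_covers: "finite X \<Longrightarrow> finite (halfspace_covers r X)"
  by (simp add: halfspace_covers_def finite_PiE finite_halfspace_sections)

lemma card_halfspace_covers:
  fixes X :: "'a::euclidean_space set"
  assumes "finite X"
  shows "card (halfspace_covers r X) \<le> (card X + 1) ^ ((DIM('a) + 1) * r)"
proof -
  have "card (halfspace_covers r X) \<le> card ({..<r} \<rightarrow>\<^sub>E halfspace_sections X)"
    unfolding halfspace_covers_def
    using assms by (intro card_mono finite_PiE finite_halfspace_sections) auto
  also have "\<dots> = card (halfspace_sections X) ^ r" by (simp add: card_PiE)
  also have "\<dots> \<le> ((card X + 1) ^ (DIM('a) + 1)) ^ r"
    using card_halfspace_sections[OF assms] by (rule power_mono) simp
  finally show ?thesis by (simp only: power_mult)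
qed

text \<open>The compact sets are replaced one after the other by half-spaces, the closed convex set \<open>T\<close>
  being the intersection of the half-spaces found so far.\<close>

lemma disjoint_compact_convex_imp_halfspace_cover:
  fixes K :: "'i \<Rightarrow> 'a::euclidean_space set"
  assumes "finite J" and "\<And>j. j \<in> J \<Longrightarrow> compact (K j)" "\<And>j. j \<in> J \<Longrightarrow> convex (K j)"
    and "closed T" "convex T" and "T \<inter> (\<Inter>j\<in>J. K j) = {}"
  shows "\<exists>c b. (\<forall>j\<in>J. K j \<subseteq> {x. c j \<bullet> x < b j}) \<and> T \<subseteq> (\<Union>j\<in>J. {x. b j \<le> c j \<bullet> x})"
  using assms
proof (induction J arbitrary: T rule: finite_induct)
  case empty
  then show ?case by simp
next
  case (insert i J)
  define L where "L = T \<inter> (\<Inter>j\<in>J. K j)"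
  have "closed L" "convex L"
    using insert.prems by (auto simp: L_def compact_imp_closed closed_INT convex_Int convex_INT)
  moreover have "K i \<inter> L = {}" using insert.prems(5) by (auto simp: L_def)
  ultimately obtain c b where cb: "\<forall>x\<in>K i. c \<bullet> x < b" "\<forall>x\<in>L. b < c \<bullet> x"
  proof (cases "K i = {}")
    case True
    then show thesis by (intro that[of 0 "-1"]) auto
  next
    case False
    with \<open>closed L\<close> \<open>convex L\<close> \<open>K i \<inter> L = {}\<close> show thesis
      using separating_hyperplane_compact_closed[of "K i" L] insert.prems(1,2) that by blast
  qed
  have "L \<inter> {x. c \<bullet> x \<le> b} = {}" using cb(2) by fastforce
  then have "T \<inter> {x. c \<bullet> x \<le> b} \<inter> (\<Inter>j\<in>J. K j) = {}" unfolding L_def by blast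
  then obtain c' b' where IH: "\<forall>j\<in>J. K j \<subseteq> {x. c' j \<bullet> x < b' j}"
    "T \<inter> {x. c \<bullet> x \<le> b} \<subseteq> (\<Union>j\<in>J. {x. b' j \<le> c' j \<bullet> x})"
    using insert.IH[of "T \<inter> {x. c \<bullet> x \<le> b}"] insert.prems
    by (auto simp: closed_Int closed_halfspace_le convex_Int convex_halfspace_le)
  show ?case
  proof (intro exI conjI)
    show "\<forall>j\<in>insert i J. K j \<subseteq> {x. (c'(i := c)) j \<bullet> x < (b'(i := b)) j}"
      using cb(1) IH(1) by auto
    show "T \<subseteq> (\<Union>j\<in>insert i J. {x. (b'(i := b)) j \<le> (c'(i := c)) j \<bullet> x})"
      using IH(2) insert.hyps(2) by fastforce
  qed
qed

lemma not_tverberg_imp_halfspace_cover: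
  fixes X Y :: "'a::euclidean_space set"
  assumes "finite Y" "indexed_partition r Y Z" "\<not> tverberg_partition r Y Z"
  obtains S where "S \<in> halfspace_covers r X" "\<And>j. j < r \<Longrightarrow> Z j \<inter> S j = {}"
proof -
  have "finite (Z j)" if "j < r" for j
    using that assms(1,2) by (auto simp: indexed_partition_def)
  moreover have "(\<Inter>j<r. convex hull (Z j)) = {}"
    using assms by (simp add: tverberg_partition_def)
  ultimately obtain c b where cb: "\<forall>j\<in>{..<r}. convex hull (Z j) \<subseteq> {x. c j \<bullet> x < b j}"
    "(UNIV :: 'a set) \<subseteq> (\<Union>j<r. {x. b j \<le> c j \<bullet> x})"
    using disjoint_compact_convex_imp_halfspace_cover[of "{..<r}" "\<lambda>j. convex hull (Z j)" UNIV]
    by (auto simp: finite_imp_compact_convex_hull)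
  define S where "S = (\<lambda>j\<in>{..<r}. X \<inter> {x. b j \<le> c j \<bullet> x})"
  show thesis
  proof
    show "S \<in> halfspace_covers r X"
      using cb(2) by (fastforce simp: halfspace_covers_def halfspace_sections_def S_def)
    show "Z j \<inter> S j = {}" if "j < r" for j
      using that cb(1) hull_subset[of "Z j" convex] by (fastforce simp: S_def)
  qed
qed

section \<open>Permutations avoiding one cell in every row\<close>

definition avoiding_permutations :: "'a set \<Rightarrow> ('a \<Rightarrow> 'a) \<Rightarrow> ('a \<Rightarrow> 'a) set" where
  "avoiding_permutations A g = {\<pi>. \<pi> permutes A \<and> (\<forall>i\<in>A. \<pi> (g i) \<noteq> i)}"

lemma finite_avoiding_permutations: "finite A \<Longrightarrow> finite (avoiding_permutations A g)"
  by (rule finite_subset[OF _ finite_permutations[of A]]) (auto simp: avoiding_permutations_def)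

lemma card_avoiding_permutations_inj_on:
  assumes "finite A" "g ` A \<subseteq> A" "inj_on g A"
  shows "card (avoiding_permutations A g) \<le> card (avoiding_permutations A id)"
proof -
  define h where "h i = (if i \<in> A then g i else i)" for i
  have "bij_betw h A A"
    using assms by (simp add: endo_inj_surj bij_betw_def h_def inj_on_def)
  then have h: "h permutes A"
    by (intro bij_imp_permutes) (auto simp: h_def)
  show ?thesis
  proof (rule card_inj_on_le[OF _ _ finite_avoiding_permutations[OF assms(1)]])
    show "inj_on (\<lambda>\<pi>. \<pi> \<circ> h) (avoiding_permutations A g)"
      by (rule inj_onI) (metis comp_assoc comp_id permutes_inv_o(1)[OF h])
    show "(\<lambda>\<pi>. \<pi> \<circ> h) ` avoiding_permutations A g \<subseteq> avoiding_permutations A id"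
      using permutes_compose[OF h] by (auto simp: h_def avoiding_permutations_def)
  qed
qed

text \<open>Exchanging the values at \<open>g i\<close> and \<open>b\<close> where needed moves the forbidden cell of row \<open>i\<close> to the
  free column \<open>b\<close>; the exchanged permutations are recognised by their value \<open>i\<close> at \<open>g i\<close>.\<close>

lemma card_avoiding_permutations_fun_upd:
  assumes "finite A" "g ` A \<subseteq> A" and i: "i \<in> A" and b: "b \<in> A - g ` A"
  shows "card (avoiding_permutations A g) \<le> card (avoiding_permutations A (g(i := b)))"
proof (rule card_inj_on_le)
  let ?\<tau> = "Transposition.transpose (g i) b"
  define \<phi> where "\<phi> \<pi> = (if \<pi> b = i then \<pi> \<circ> ?\<tau> else \<pi>)" for \<pi> :: "'a \<Rightarrow> 'a"
  show "finite (avoiding_permutations A (g(i := b)))"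
    using assms(1) by (rule finite_avoiding_permutations)
  show "\<phi> ` avoiding_permutations A g \<subseteq> avoiding_permutations A (g(i := b))"
  proof (rule image_subsetI)
    fix \<pi> assume "\<pi> \<in> avoiding_permutations A g"
    then have \<pi>: "\<pi> permutes A" "\<And>k. k \<in> A \<Longrightarrow> \<pi> (g k) \<noteq> k"
      by (auto simp: avoiding_permutations_def)
    have "\<phi> \<pi> permutes A"
      using \<pi>(1) assms(2) i b by (auto simp: \<phi>_def intro!: permutes_compose permutes_swap_id)
    moreover have "\<phi> \<pi> ((g(i := b)) k) \<noteq> k" if "k \<in> A" for k
      using \<pi>(2)[OF that] \<pi>(2)[OF i] b that by (auto simp: \<phi>_def Transposition.transpose_def)
    ultimately show "\<phi> \<pi> \<in> avoiding_permutations A (g(i := b))"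
      by (simp add: avoiding_permutations_def)
  qed
  show "inj_on \<phi> (avoiding_permutations A g)"
  proof (rule inj_onI)
    fix \<pi> \<sigma>
    assume avoid: "\<pi> \<in> avoiding_permutations A g" "\<sigma> \<in> avoiding_permutations A g"
      and eq: "\<phi> \<pi> = \<phi> \<sigma>"
    have "\<pi> (g i) \<noteq> i" "\<sigma> (g i) \<noteq> i" using avoid i by (auto simp: avoiding_permutations_def)
    moreover have "\<phi> \<rho> (g i) = i \<longleftrightarrow> \<rho> b = i" if "\<rho> (g i) \<noteq> i" for \<rho>
      using that by (simp add: \<phi>_def)
    ultimately have exchanged: "\<pi> b = i \<longleftrightarrow> \<sigma> b = i" using eq by metis
    show "\<pi> = \<sigma>"
    proof (cases "\<pi> b = i")
      case True
      then have "\<pi> \<circ> ?\<tau> \<circ> ?\<tau> = \<sigma> \<circ> ?\<tau> \<circ> ?\<tau>" using eq exchanged by (simp add: \<phi>_def)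
      then show ?thesis by (simp add: comp_assoc)
    next
      case False
      then show ?thesis using eq exchanged by (simp add: \<phi>_def)
    qed
  qed
qed

lemma card_avoiding_permutations_le_derangements:
  assumes "finite A" "g ` A \<subseteq> A"
  shows "card (avoiding_permutations A g) \<le> card (avoiding_permutations A id)"
  using assms(2)
proof (induction "card (A - g ` A)" arbitrary: g rule: less_induct)
  case less
  show ?case
  proof (cases "inj_on g A")
    case True
    then show ?thesis using assms(1) less.prems by (intro card_avoiding_permutations_inj_on)
  next
    case False
    then obtain i i' where i: "i \<in> A" "i' \<in> A" "i \<noteq> i'" "g i = g i'" by (auto simp: inj_on_def)
    have "g ` A \<noteq> A" using False assms(1) by (metis finite_surj_inj order_refl)
    then obtain b where b: "b \<in> A - g ` A" using less.prems by blast
    have image: "(g(i := b)) ` A = insert b (g ` A)"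
      using i by (auto simp: image_iff)
    have "A - (g(i := b)) ` A \<subset> A - g ` A" and g': "(g(i := b)) ` A \<subseteq> A"
      using b less.prems unfolding image by blast+
    then have "card (A - (g(i := b)) ` A) < card (A - g ` A)"
      using assms(1) by (intro psubset_card_mono) auto
    then have "card (avoiding_permutations A (g(i := b))) \<le> card (avoiding_permutations A id)"
      using g' by (rule less.hyps)
    moreover have "card (avoiding_permutations A g) \<le> card (avoiding_permutations A (g(i := b)))"
      using assms(1) less.prems i(1) b by (rule card_avoiding_permutations_fun_upd)
    ultimately show ?thesis by simp
  qed
qed

definition uniform_permutation :: "'a set \<Rightarrow> ('a \<Rightarrow> 'a) pmf" where
  "uniform_permutation A = pmf_of_set {\<pi>. \<pi> permutes A}"

lemma set_pmf_uniform_permutation: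
  "finite A \<Longrightarrow> set_pmf (uniform_permutation A) = {\<pi>. \<pi> permutes A}"
  unfolding uniform_permutation_def
  by (subst set_pmf_of_set) (auto simp: finite_permutations intro: permutes_id)

lemma prob_uniform_permutation:
  assumes "finite A"
  shows "measure_pmf.prob (uniform_permutation A) E = card ({\<pi>. \<pi> permutes A} \<inter> E) / fact (card A)"
proof -
  have "{\<pi>. \<pi> permutes A} \<noteq> {}" using permutes_id by blast
  then show ?thesis
    unfolding uniform_permutation_def using assms
    by (simp add: measure_pmf_of_set finite_permutations card_permutations)
qed

lemma one_minus_fixpoint_prob:
  "1 - fixpoint_prob r =
    measure_pmf.prob (uniform_permutation {..<r}) (avoiding_permutations {..<r} id)"
proof -
  let ?U = "uniform_permutation {..<r}"
  have "1 - fixpoint_prob r = measure_pmf.prob ?U (- {\<pi>. \<exists>i<r. \<pi> i = i})"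
    unfolding fixpoint_prob_def uniform_permutation_def
    by (subst measure_pmf.prob_compl[symmetric]) (auto simp: Compl_eq_Diff_UNIV)
  also have "\<dots> = measure_pmf.prob ?U (- {\<pi>. \<exists>i<r. \<pi> i = i} \<inter> set_pmf ?U)"
    by (rule measure_Int_set_pmf[symmetric])
  also have "- {\<pi>. \<exists>i<r. \<pi> i = i} \<inter> set_pmf ?U = avoiding_permutations {..<r} id"
    by (auto simp: set_pmf_uniform_permutation avoiding_permutations_def)
  finally show ?thesis .
qed

lemma fixpoint_prob_pos: "r > 0 \<Longrightarrow> 0 < fixpoint_prob r"
  unfolding fixpoint_prob_def uniform_permutation_def[symmetric]
  by (rule measure_pmf_posI[of id]) (auto simp: set_pmf_uniform_permutation)

lemma fixpoint_prob_less_1: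
  assumes "r \<ge> 2"
  shows "fixpoint_prob r < 1"
proof -
  define s where "s i = (if i < r then Suc i mod r else i)" for i
  have "inj_on s {..<r}" by (auto simp: s_def inj_on_def mod_Suc split: if_splits)
  moreover have "s ` {..<r} \<subseteq> {..<r}" using assms by (auto simp: s_def)
  ultimately have "bij_betw s {..<r} {..<r}" by (simp add: bij_betw_def endo_inj_surj)
  then have s: "s permutes {..<r}" by (rule bij_imp_permutes) (simp add: s_def)
  moreover have "s i \<noteq> i" if "i < r" for i using that assms by (simp add: s_def mod_Suc)
  ultimately have "s \<in> avoiding_permutations {..<r} id" by (simp add: avoiding_permutations_def)
  with s have "0 < 1 - fixpoint_prob r"
    unfolding one_minus_fixpoint_prob
    by (intro measure_pmf_posI[of s]) (simp_all add: set_pmf_uniform_permutation)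
  then show ?thesis by simp
qed

definition evades :: "nat \<Rightarrow> (nat \<Rightarrow> 'a set) \<Rightarrow> (nat \<Rightarrow> 'a) \<Rightarrow> bool" where
  "evades r S x \<longleftrightarrow> (\<forall>j<r. x j \<notin> S j)"

lemma prob_permutation_evades_le:
  assumes "e ` {..<r} \<subseteq> (\<Union>j<r. S j)"
  shows "measure_pmf.prob (uniform_permutation {..<r}) {\<pi>. evades r S (e \<circ> \<pi>)}
    \<le> 1 - fixpoint_prob r"
proof -
  let ?P = "{\<pi>. \<pi> permutes {..<r}}"
  have "\<exists>j<r. e i \<in> S j" if "i < r" for i using assms that by blast
  then obtain g where g: "\<And>i. i < r \<Longrightarrow> g i < r \<and> e i \<in> S (g i)" by metis
  have "?P \<inter> {\<pi>. evades r S (e \<circ> \<pi>)} \<subseteq> avoiding_permutations {..<r} g"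
    using g by (fastforce simp: evades_def avoiding_permutations_def)
  then have "card (?P \<inter> {\<pi>. evades r S (e \<circ> \<pi>)}) \<le> card (avoiding_permutations {..<r} g)"
    by (intro card_mono finite_avoiding_permutations) auto
  also have "\<dots> \<le> card (avoiding_permutations {..<r} id)"
    using g by (intro card_avoiding_permutations_le_derangements) auto
  also have "avoiding_permutations {..<r} id = ?P \<inter> avoiding_permutations {..<r} id"
    by (auto simp: avoiding_permutations_def)
  finally show ?thesis
    unfolding one_minus_fixpoint_prob prob_uniform_permutation[OF finite_lessThan]
    by (simp add: divide_right_mono del: o_apply)
qed

lemma prob_permutations_evade_le:
  assumes S: "S \<in> {..<m} \<rightarrow>\<^sub>E halfspace_covers r X" and e: "e ` {..<r} \<subseteq> X"
  shows "measure_pmf.prob (Pi_pmf {..<m} d (\<lambda>_. uniform_permutation {..<r}))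
    {\<pi>. \<forall>k<m. evades r (S k) (e \<circ> \<pi> k)} \<le> (1 - fixpoint_prob r) ^ m"
proof -
  let ?U = "uniform_permutation {..<r}"
  have "X \<subseteq> (\<Union>j<r. S k j)" if "k < m" for k
    using PiE_mem[OF S] that by (simp add: halfspace_covers_def)
  with e have covers: "e ` {..<r} \<subseteq> (\<Union>j<r. S k j)" if "k < m" for k
    using that by (meson subset_trans)
  have "{\<pi>. \<forall>k<m. evades r (S k) (e \<circ> \<pi> k)} = (\<Pi> k\<in>{..<m}. {\<pi>. evades r (S k) (e \<circ> \<pi>)})"
    by auto
  then have "measure_pmf.prob (Pi_pmf {..<m} d (\<lambda>_. ?U)) {\<pi>. \<forall>k<m. evades r (S k) (e \<circ> \<pi> k)} =
      (\<Prod>k<m. measure_pmf.prob ?U {\<pi>. evades r (S k) (e \<circ> \<pi>)})"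
    by (simp add: measure_Pi_pmf_Pi)
  also have "\<dots> \<le> (\<Prod>k<m. 1 - fixpoint_prob r)"
    using covers by (intro prod_mono conjI prob_permutation_evades_le) auto
  finally show ?thesis by simp
qed

section \<open>Concentration and the union bound\<close>

lemma prob_Pi_pmf_many_bad_le:
  fixes q \<epsilon> :: real
  assumes "finite I" "q \<le> \<epsilon>" and bad: "\<And>i. i \<in> I \<Longrightarrow> measure_pmf.prob (p i) (B i) \<le> q"
  shows "measure_pmf.prob (Pi_pmf I d p) {\<omega>. \<epsilon> * card I \<le> card {i \<in> I. \<omega> i \<in> B i}}
    \<le> exp (- 2 * (\<epsilon> - q)\<^sup>2 * card I)"
proof (cases "I = {}")
  case False
  let ?M = "Pi_pmf I d p" and ?X = "\<lambda>i \<omega>. indicat_real (B i) (\<omega> i)"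
  define \<mu> where "\<mu> = (\<Sum>i\<in>I. measure_pmf.expectation ?M (?X i))"
  have hoeffding: "Hoeffding_ineq ?M I ?X (\<lambda>_. 0) (\<lambda>_. 1)"
  proof (intro Hoeffding_ineq.intro indep_interval_bounded_random_variables.intro
      indep_interval_bounded_random_variables_axioms.intro prob_space_measure_pmf)
    show "prob_space.indep_vars (measure_pmf ?M) (\<lambda>_. borel) ?X I"
      using prob_space_measure_pmf indep_vars_Pi_pmf[OF assms(1)]
      by (rule prob_space.indep_vars_compose2) auto
  qed (use assms(1) in \<open>auto simp: indicator_def\<close>)
  have "measure_pmf.expectation ?M (?X i) = measure_pmf.prob (p i) (B i)" if "i \<in> I" for i
  proof -
    have "measure_pmf.expectation ?M (?X i) =
        measure_pmf.expectation (map_pmf (\<lambda>\<omega>. \<omega> i) ?M) (indicat_real (B i))"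
      by (rule integral_map_pmf[symmetric])
    then show ?thesis using that assms(1) by (simp add: Pi_pmf_component)
  qed
  then have "\<mu> \<le> (\<Sum>i\<in>I. q)" unfolding \<mu>_def using bad by (intro sum_mono) simp
  moreover have "(\<Sum>i\<in>I. ?X i \<omega>) = card {i \<in> I. \<omega> i \<in> B i}" for \<omega>
    using assms(1) by (simp add: indicator_def sum.If_cases Int_def)
  ultimately have "measure_pmf.prob ?M {\<omega>. \<epsilon> * card I \<le> card {i \<in> I. \<omega> i \<in> B i}}
      \<le> measure_pmf.prob ?M {\<omega>. \<mu> + (\<epsilon> - q) * card I \<le> (\<Sum>i\<in>I. ?X i \<omega>)}"
    by (intro measure_pmf.finite_measure_mono) (auto simp: algebra_simps)
  also have "\<dots> \<le> exp (- 2 * ((\<epsilon> - q) * card I)\<^sup>2 / card I)"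
    using Hoeffding_ineq.Hoeffding_ineq_ge[OF hoeffding, of "(\<epsilon> - q) * card I"] assms(1,2) False
    by (simp add: \<mu>_def card_gt_0_iff)
  also have "\<dots> = exp (- 2 * (\<epsilon> - q)\<^sup>2 * card I)"
    using assms(1) False by (simp add: power2_eq_square)
  finally show ?thesis .
qed simp

lemma exists_selection_few_bad:
  fixes q \<epsilon> :: real
  assumes "finite I" "finite \<S>" "q \<le> \<epsilon>"
    and bad: "\<And>S i. S \<in> \<S> \<Longrightarrow> i \<in> I \<Longrightarrow> measure_pmf.prob (p i) (B S i) \<le> q"
    and small: "card \<S> * exp (- 2 * (\<epsilon> - q)\<^sup>2 * card I) < 1"
  shows "\<exists>\<omega>. (\<forall>i\<in>I. \<omega> i \<in> set_pmf (p i)) \<and>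
    (\<forall>S\<in>\<S>. card {i \<in> I. \<omega> i \<in> B S i} < \<epsilon> * card I)"
proof -
  let ?M = "Pi_pmf I undefined p"
  define E where "E S = {\<omega>. \<epsilon> * card I \<le> card {i \<in> I. \<omega> i \<in> B S i}}" for S
  have "measure_pmf.prob ?M (\<Union>S\<in>\<S>. E S) \<le> (\<Sum>S\<in>\<S>. measure_pmf.prob ?M (E S))"
    using assms(2) by (intro measure_pmf.finite_measure_subadditive_finite) auto
  also have "\<dots> \<le> (\<Sum>S\<in>\<S>. exp (- 2 * (\<epsilon> - q)\<^sup>2 * card I))"
    unfolding E_def using assms by (intro sum_mono prob_Pi_pmf_many_bad_le)
  also have "\<dots> < 1" using small by simp
  finally have "measure_pmf.prob ?M (\<Union>S\<in>\<S>. E S) \<noteq> 1" by simp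
  then have "\<not> set_pmf ?M \<subseteq> (\<Union>S\<in>\<S>. E S)"
    by (auto simp: measure_pmf.prob_eq_1 AE_measure_pmf_iff)
  then obtain \<omega> where "\<omega> \<in> set_pmf ?M" "\<And>S. S \<in> \<S> \<Longrightarrow> \<omega> \<notin> E S" by blast
  then show ?thesis
    using assms(1) by (intro exI[of _ \<omega>]) (auto simp: E_def set_Pi_pmf PiE_dflt_def not_le)
qed

lemma eventually_poly_times_exp_less_1:
  fixes a c :: real
  assumes "a \<ge> 0" "c > 0"
  shows "\<forall>\<^sub>F n in sequentially. (a * real n + 1) ^ K * exp (- c * real n) < 1"
proof -
  define x where "x n = c * (1 + real n)" for n
  define C where "C = ((a + 1) / c) ^ K * exp c"
  have "filterlim x at_top sequentially"
    unfolding x_def using \<open>c > 0\<close>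
    by (intro filterlim_tendsto_pos_mult_at_top[OF tendsto_const]
        filterlim_tendsto_add_at_top[OF tendsto_const] filterlim_real_sequentially)
  then have "(\<lambda>n. C * (x n ^ K / exp (x n))) \<longlonglongrightarrow> C * 0"
    by (intro tendsto_mult tendsto_const filterlim_compose[OF tendsto_power_div_exp_0])
  then have "\<forall>\<^sub>F n in sequentially. C * (x n ^ K / exp (x n)) < 1"
    by (rule order_tendstoD(2)) simp
  then show ?thesis
  proof (rule eventually_mono)
    fix n assume less_1: "C * (x n ^ K / exp (x n)) < 1"
    have exp_eq: "exp (- c * real n) = exp c / exp (x n)"
      by (simp add: x_def exp_add exp_minus field_simps)
    have "(a + 1) / c * x n = (a + 1) * (1 + real n)" using \<open>c > 0\<close> by (simp add: x_def)
    then have "a * real n + 1 \<le> (a + 1) / c * x n" using \<open>a \<ge> 0\<close> by (simp add: algebra_simps)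
    then have "(a * real n + 1) ^ K * exp (- c * real n)
        \<le> ((a + 1) / c * x n) ^ K * exp (- c * real n)"
      using assms by (intro mult_right_mono power_mono) auto
    also have "\<dots> = C * (x n ^ K / exp (x n))"
      unfolding exp_eq C_def power_mult_distrib by simp
    finally show "(a * real n + 1) ^ K * exp (- c * real n) < 1" using less_1 by linarith
  qed
qed

section \<open>Colorful partitions\<close>

definition transversal_partition :: "'a set set \<Rightarrow> ('a set \<Rightarrow> nat \<Rightarrow> 'a) \<Rightarrow> nat \<Rightarrow> 'a set" where
  "transversal_partition \<F> f j = (\<lambda>F. f F j) ` \<F>"

lemma colorful_partition_transversal_partition:
  assumes "pairwise disjnt \<F>" and f: "\<And>F. F \<in> \<F> \<Longrightarrow> bij_betw (f F) {..<r} F"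
  shows "colorful_partition r \<F> (transversal_partition \<F> f)"
proof -
  have mem: "f F j \<in> F" if "F \<in> \<F>" "j < r" for F j
    using bij_betw_apply[OF f[OF that(1)]] that(2) by blast
  have eq: "F = F'" if "F \<in> \<F>" "F' \<in> \<F>" "x \<in> F" "x \<in> F'" for F F' x
    using assms(1) that unfolding pairwise_def disjnt_def by blast
  have "(\<Union>j<r. transversal_partition \<F> f j) = (\<Union>F\<in>\<F>. f F ` {..<r})"
    by (auto simp: transversal_partition_def)
  also have "\<dots> = \<Union>\<F>" using f by (auto simp: bij_betw_def)
  finally have "(\<Union>j<r. transversal_partition \<F> f j) = \<Union>\<F>" .
  moreover have "transversal_partition \<F> f j \<inter> transversal_partition \<F> f k = {}"
    if jk: "j < r" "k < r" "j \<noteq> k" for j k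
  proof (rule equals0I)
    fix x assume "x \<in> transversal_partition \<F> f j \<inter> transversal_partition \<F> f k"
    then obtain F F' where F: "F \<in> \<F>" "x = f F j" "F' \<in> \<F>" "x = f F' k"
      by (auto simp: transversal_partition_def)
    then have "F = F'" using eq mem jk by metis
    then show False using bij_betw_imp_inj_on[OF f[OF F(1)]] F jk by (auto dest: inj_onD)
  qed
  moreover have "F \<inter> transversal_partition \<F> f j = {f F j}" if "F \<in> \<F>" "j < r" for F j
    using that mem eq unfolding transversal_partition_def by blast
  ultimately show ?thesis
    by (simp add: colorful_partition_def indexed_partition_def disjoint_family_on_def)
qed

lemma colorful_partition_restrict:
  assumes "colorful_partition r \<F> X" "\<G> \<subseteq> \<F>"
  shows "colorful_partition r \<G> (restrict_partition X (\<Union>\<G>))"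
proof -
  have "F \<inter> (X j \<inter> \<Union>\<G>) = F \<inter> X j" if "F \<in> \<G>" for F j using that by blast
  moreover have "disjoint_family_on (\<lambda>j. X j \<inter> \<Union>\<G>) {..<r}"
    using assms(1) unfolding colorful_partition_def indexed_partition_def disjoint_family_on_def
    by blast
  ultimately show ?thesis
    using assms unfolding colorful_partition_def indexed_partition_def restrict_partition_def
    by auto
qed

lemma not_tverberg_restrict_imp_evades:
  fixes \<F> :: "'a::euclidean_space set set"
  assumes "pairwise disjnt \<F>" and f: "\<And>F. F \<in> \<F> \<Longrightarrow> bij_betw (f F) {..<r} F"
    and "\<G> \<subseteq> \<F>" "finite \<G>"
    and not_tverberg:
      "\<not> tverberg_partition r (\<Union>\<G>) (restrict_partition (transversal_partition \<F> f) (\<Union>\<G>))"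
  obtains S where "S \<in> halfspace_covers r X" "\<And>F. F \<in> \<G> \<Longrightarrow> evades r S (f F)"
proof -
  let ?Z = "restrict_partition (transversal_partition \<F> f) (\<Union>\<G>)"
  have "colorful_partition r \<G> ?Z"
    using colorful_partition_transversal_partition[OF assms(1) f] assms(3)
    by (rule colorful_partition_restrict)
  then have "indexed_partition r (\<Union>\<G>) ?Z" by (simp add: colorful_partition_def)
  moreover have "finite (\<Union>\<G>)"
    using assms(3,4) f bij_betw_finite by blast
  ultimately obtain S where S: "S \<in> halfspace_covers r X" "\<And>j. j < r \<Longrightarrow> ?Z j \<inter> S j = {}"
    using not_tverberg by (metis not_tverberg_imp_halfspace_cover)
  have "f F j \<in> ?Z j" if "F \<in> \<G>" "j < r" for F j
    using that assms(3) bij_betw_apply[OF f, of F j]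
    by (auto simp: restrict_partition_def transversal_partition_def)
  then have "evades r S (f F)" if "F \<in> \<G>" for F
    using that S(2) by (auto simp: evades_def)
  with S(1) show thesis by (rule that)
qed

lemma
  assumes "color_family r N \<F>"
  shows finite_Union_color_family: "finite (\<Union>\<F>)"
    and card_Union_color_family_le: "card (\<Union>\<F>) \<le> r * N"
proof -
  have F: "finite \<F>" "card \<F> = N" "\<And>F. F \<in> \<F> \<Longrightarrow> finite F \<and> card F = r"
    using assms by (auto simp: color_family_def)
  then show "finite (\<Union>\<F>)" by auto
  have "card (\<Union>\<F>) \<le> (\<Sum>F\<in>\<F>. card F)" by (rule card_Union_le_sum_card)
  also have "\<dots> = r * N" using F by (simp add: mult.commute)
  finally show "card (\<Union>\<F>) \<le> r * N" .
qed

lemma card_halfspace_cover_sequences_le: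
  fixes \<F> :: "'a::euclidean_space set set"
  assumes "color_family r N \<F>"
  shows "real (card ({..<m} \<rightarrow>\<^sub>E halfspace_covers r (\<Union>\<F>)))
    \<le> (real r * N + 1) ^ ((DIM('a) + 1) * r * m)"
proof -
  have "card ({..<m} \<rightarrow>\<^sub>E halfspace_covers r (\<Union>\<F>)) = card (halfspace_covers r (\<Union>\<F>)) ^ m"
    by (simp add: card_PiE)
  also have "\<dots> \<le> ((card (\<Union>\<F>) + 1) ^ ((DIM('a) + 1) * r)) ^ m"
    using finite_Union_color_family[OF assms] by (intro power_mono card_halfspace_covers) auto
  also have "\<dots> \<le> ((r * N + 1) ^ ((DIM('a) + 1) * r)) ^ m"
    using card_Union_color_family_le[OF assms] by (intro power_mono) auto
  finally have "real (card ({..<m} \<rightarrow>\<^sub>E halfspace_covers r (\<Union>\<F>)))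
      \<le> real ((r * N + 1) ^ ((DIM('a) + 1) * r * m))"
    by (simp only: of_nat_le_iff power_mult)
  also have "\<dots> = (real r * N + 1) ^ ((DIM('a) + 1) * r * m)" by (simp add: add.commute)
  finally show ?thesis .
qed

lemma exists_transversals_few_evading:
  fixes \<F> :: "'a::euclidean_space set set" and \<epsilon> :: real and r m :: nat
  defines "q \<equiv> (1 - fixpoint_prob r) ^ m"
  assumes \<F>: "color_family r N \<F>" and "q \<le> \<epsilon>"
    and small: "(real r * N + 1) ^ ((DIM('a) + 1) * r * m) * exp (- 2 * (\<epsilon> - q)\<^sup>2 * N) < 1"
  obtains f :: "nat \<Rightarrow> 'a set \<Rightarrow> nat \<Rightarrow> 'a"
  where "\<And>k F. k < m \<Longrightarrow> F \<in> \<F> \<Longrightarrow> bij_betw (f k F) {..<r} F"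
    "\<And>S. S \<in> {..<m} \<rightarrow>\<^sub>E halfspace_covers r (\<Union>\<F>) \<Longrightarrow>
      card {F \<in> \<F>. \<forall>k<m. evades r (S k) (f k F)} < \<epsilon> * N"
proof -
  let ?W = "halfspace_covers r (\<Union>\<F>)"
  have fin: "finite \<F>" "card \<F> = N" and card_r: "\<And>F. F \<in> \<F> \<Longrightarrow> finite F \<and> card F = r"
    using \<F> by (auto simp: color_family_def)
  have "\<exists>e. bij_betw e {..<r} F" if "F \<in> \<F>" for F
    using ex_bij_betw_nat_finite[of F] card_r[OF that] by (auto simp: atLeast0LessThan)
  then obtain e where e: "\<And>F. F \<in> \<F> \<Longrightarrow> bij_betw (e F) {..<r} F" by metis
  let ?p = "Pi_pmf {..<m} undefined (\<lambda>_. uniform_permutation {..<r})"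
  let ?B = "\<lambda>S F. {\<pi>. \<forall>k<m. evades r (S k) (e F \<circ> \<pi> k)}"
  have finite_W: "finite ({..<m} \<rightarrow>\<^sub>E ?W)"
    using finite_Union_color_family[OF \<F>] by (simp add: finite_PiE finite_halfspace_covers)
  have bad: "measure_pmf.prob ?p (?B S F) \<le> q" if "S \<in> {..<m} \<rightarrow>\<^sub>E ?W" "F \<in> \<F>" for S F
    unfolding q_def using that e by (intro prob_permutations_evade_le) (auto simp: bij_betw_def)
  have "card ({..<m} \<rightarrow>\<^sub>E ?W) * exp (- 2 * (\<epsilon> - q)\<^sup>2 * N)
      \<le> (real r * N + 1) ^ ((DIM('a) + 1) * r * m) * exp (- 2 * (\<epsilon> - q)\<^sup>2 * N)"
    using card_halfspace_cover_sequences_le[OF \<F>] by (rule mult_right_mono) simp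
  with small have union_bound: "card ({..<m} \<rightarrow>\<^sub>E ?W) * exp (- 2 * (\<epsilon> - q)\<^sup>2 * card \<F>) < 1"
    unfolding fin(2) by linarith
  have "\<exists>\<omega>. (\<forall>F\<in>\<F>. \<omega> F \<in> set_pmf ?p) \<and>
      (\<forall>S\<in>{..<m} \<rightarrow>\<^sub>E ?W. card {F \<in> \<F>. \<omega> F \<in> ?B S F} < \<epsilon> * card \<F>)"
    by (intro exists_selection_few_bad[where q = q] fin(1) finite_W \<open>q \<le> \<epsilon>\<close> bad union_bound)
  then obtain \<omega> where \<omega>: "\<forall>F\<in>\<F>. \<omega> F \<in> set_pmf ?p"
    "\<forall>S\<in>{..<m} \<rightarrow>\<^sub>E ?W. card {F \<in> \<F>. \<omega> F \<in> ?B S F} < \<epsilon> * card \<F>"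
    by blast
  show thesis
  proof (rule that[of "\<lambda>k F. e F \<circ> \<omega> F k"])
    fix k F assume "k < m" "F \<in> \<F>"
    then have "\<omega> F k permutes {..<r}"
      using \<omega>(1) by (auto simp: set_Pi_pmf PiE_dflt_def set_pmf_uniform_permutation)
    then show "bij_betw (e F \<circ> \<omega> F k) {..<r} F"
      by (rule bij_betw_trans[OF permutes_imp_bij e[OF \<open>F \<in> \<F>\<close>]])
  qed (use \<omega>(2) fin in auto)
qed

lemma has_tverberg_cover_color_family:
  fixes \<F> :: "'a::euclidean_space set set" and \<epsilon> :: real and r m :: nat
  defines "q \<equiv> (1 - fixpoint_prob r) ^ m"
  assumes \<F>: "color_family r N \<F>" and "q \<le> \<epsilon>"
    and small: "(real r * N + 1) ^ ((DIM('a) + 1) * r * m) * exp (- 2 * (\<epsilon> - q)\<^sup>2 * N) < 1"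
  shows "has_tverberg_cover \<epsilon> r m \<F>"
proof -
  have fin: "finite \<F>" "card \<F> = N" and disj: "pairwise disjnt \<F>"
    using \<F> by (auto simp: color_family_def)
  let ?W = "halfspace_covers r (\<Union>\<F>)"
  obtain f where f: "\<And>k F. k < m \<Longrightarrow> F \<in> \<F> \<Longrightarrow> bij_betw (f k F) {..<r} F"
    and few: "\<And>S. S \<in> {..<m} \<rightarrow>\<^sub>E ?W \<Longrightarrow> card {F \<in> \<F>. \<forall>k<m. evades r (S k) (f k F)} < \<epsilon> * N"
    using \<F> assms(3,4) unfolding q_def by (rule exists_transversals_few_evading) (rule that)
  let ?P = "\<lambda>k. transversal_partition \<F> (f k)"
  have "\<exists>k<m. tverberg_partition r (\<Union>\<G>) (restrict_partition (?P k) (\<Union>\<G>))"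
    if \<G>: "\<G> \<subseteq> \<F>" "\<epsilon> * real (card \<F>) \<le> real (card \<G>)" for \<G>
  proof (rule ccontr)
    assume no_tverberg: "\<not> ?thesis"
    have "\<exists>S\<in>?W. \<forall>F\<in>\<G>. evades r S (f k F)" if "k < m" for k
      using not_tverberg_restrict_imp_evades[OF disj f[OF that] \<G>(1) finite_subset[OF \<G>(1) fin(1)]]
        no_tverberg that by metis
    then obtain S where S: "\<And>k. k < m \<Longrightarrow> S k \<in> ?W \<and> (\<forall>F\<in>\<G>. evades r (S k) (f k F))" by metis
    have "restrict S {..<m} \<in> {..<m} \<rightarrow>\<^sub>E ?W" using S by (simp add: restrict_PiE_iff)
    then have "card {F \<in> \<F>. \<forall>k<m. evades r (restrict S {..<m} k) (f k F)} < \<epsilon> * N" by (rule few)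
    moreover have "card \<G> \<le> card {F \<in> \<F>. \<forall>k<m. evades r (restrict S {..<m} k) (f k F)}"
      using S \<G>(1) fin(1) by (intro card_mono) auto
    ultimately show False using \<G>(2) unfolding fin(2) by linarith
  qed
  moreover have "colorful_partition r \<F> (?P k)" if "k < m" for k
    using disj f[OF that] by (rule colorful_partition_transversal_partition)
  ultimately show ?thesis unfolding has_tverberg_cover_def by (intro exI[of _ ?P]) blast
qed

lemma has_tverberg_cover_large_families:
  fixes \<epsilon> :: real
  assumes "(1 - fixpoint_prob r) ^ m < \<epsilon>"
  shows "\<exists>N0. \<forall>N\<ge>N0. \<forall>\<F> :: 'a::euclidean_space set set.
    color_family r N \<F> \<longrightarrow> has_tverberg_cover \<epsilon> r m \<F>"
proof -
  let ?q = "(1 - fixpoint_prob r) ^ m"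
  have "\<forall>\<^sub>F N in sequentially.
      (real r * real N + 1) ^ ((DIM('a) + 1) * r * m) * exp (- (2 * (\<epsilon> - ?q)\<^sup>2) * real N) < 1"
    using assms by (intro eventually_poly_times_exp_less_1) auto
  then obtain N0 where "\<forall>N\<ge>N0.
      (real r * real N + 1) ^ ((DIM('a) + 1) * r * m) * exp (- (2 * (\<epsilon> - ?q)\<^sup>2) * real N) < 1"
    unfolding eventually_sequentially by blast
  then show ?thesis
    using assms by (intro exI[of _ N0] allI impI has_tverberg_cover_color_family) auto
qed

lemma has_tverberg_cover_colorful_restrictions:
  assumes "has_tverberg_cover \<epsilon> r m \<F>"
  shows "\<exists>P. (\<forall>k<m. colorful_partition r \<F> (P k)) \<and>
    (\<forall>\<G>. \<G> \<subseteq> \<F> \<and> real (card \<G>) \<ge> \<epsilon> * real (card \<F>) \<longrightarrow>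
      (\<forall>k<m. colorful_partition r \<G> (restrict_partition (P k) (\<Union>\<G>))) \<and>
      (\<exists>k<m. tverberg_partition r (\<Union>\<G>) (restrict_partition (P k) (\<Union>\<G>))))"
proof -
  from assms obtain P where "\<forall>k<m. colorful_partition r \<F> (P k)"
    "\<forall>\<G>. \<G> \<subseteq> \<F> \<and> real (card \<G>) \<ge> \<epsilon> * real (card \<F>) \<longrightarrow>
      (\<exists>k<m. tverberg_partition r (\<Union>\<G>) (restrict_partition (P k) (\<Union>\<G>)))"
    unfolding has_tverberg_cover_def by blast
  then show ?thesis by (intro exI[of _ P]) (blast intro: colorful_partition_restrict)
qed

lemma power_nat_floor_log_less:
  fixes u \<epsilon> :: real
  assumes "0 < u" "u < 1" "0 < \<epsilon>"
  shows "u ^ nat (\<lfloor>ln \<epsilon> / ln u\<rfloor> + 1) < \<epsilon>"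
proof -
  let ?m = "nat (\<lfloor>ln \<epsilon> / ln u\<rfloor> + 1)"
  have "ln \<epsilon> / ln u < real ?m" by linarith
  then have "ln (u ^ ?m) < ln \<epsilon>" using assms by (simp add: ln_realpow neg_divide_less_eq)
  then show ?thesis using assms by simp
qed

theorem theorem4p2:
  fixes r m :: nat and \<epsilon> :: real
  assumes "r \<ge> 2" and "0 < \<epsilon>" and "\<epsilon> \<le> 1"
    and "m = nat (\<lfloor>ln \<epsilon> / ln (1 - fixpoint_prob r)\<rfloor> + 1)"
  shows "(\<exists>N0. \<forall>N\<ge>N0. \<forall>\<F> :: (real ^ 'd::finite) set set.
            color_family r N \<F> \<longrightarrow>
            (\<exists>P :: nat \<Rightarrow> nat \<Rightarrow> (real ^ 'd) set.
               (\<forall>k<m. colorful_partition r \<F> (P k)) \<and>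
               (\<forall>\<G>. \<G> \<subseteq> \<F> \<and> real (card \<G>) \<ge> \<epsilon> * real (card \<F>) \<longrightarrow>
                  (\<forall>k<m. colorful_partition r \<G> (restrict_partition (P k) (\<Union>\<G>))) \<and>
                  (\<exists>k<m. tverberg_partition r (\<Union>\<G>) (restrict_partition (P k) (\<Union>\<G>))))))
       \<and> int (m_col TYPE('d) \<epsilon> r) \<le> \<lfloor>ln \<epsilon> / ln (1 - fixpoint_prob r)\<rfloor> + 1"
proof -
  let ?u = "1 - fixpoint_prob r"
  have u: "0 < ?u" "?u < 1"
    using assms(1) fixpoint_prob_less_1 fixpoint_prob_pos[of r] by auto
  then have "?u ^ m < \<epsilon>"
    unfolding assms(4) using assms(2) by (rule power_nat_floor_log_less)
  then have "\<exists>N0. \<forall>N\<ge>N0. \<forall>\<F> :: (real ^ 'd) set set.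
      color_family r N \<F> \<longrightarrow> has_tverberg_cover \<epsilon> r m \<F>" (is "\<exists>N0. ?covers N0")
    by (rule has_tverberg_cover_large_families)
  then obtain N0 where N0: "?covers N0" by blast
  then have "m_col TYPE('d) \<epsilon> r \<le> m" unfolding m_col_def by (intro Least_le exI)
  moreover have "0 \<le> ln \<epsilon> / ln ?u" using u assms(2,3) by (simp add: divide_nonpos_neg)
  then have "int m = \<lfloor>ln \<epsilon> / ln ?u\<rfloor> + 1" using assms(4) by simp
  ultimately have "int (m_col TYPE('d) \<epsilon> r) \<le> \<lfloor>ln \<epsilon> / ln ?u\<rfloor> + 1" by simp
  with N0 show ?thesis
    by (intro conjI exI[of _ N0] allI impI has_tverberg_cover_colorful_restrictions) auto
qed

end
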